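(* Let $G$ be a finite group. Then the following statements are equivalent: (i) $\mathcal{P}^{o}(G)=\mathcal{P}_e^{o}(G)$; (ii) $\mathcal{P}^{c}(G)=\mathcal{P}_e^{c}(G)$; (iii) every cyclic subgroup of $G$ has prime power order.
   Context: All graphs are simple and undirected with vertex set $G$; equality of two such graphs means they have the same edge set. The power graph $\mathcal{P}(G)$: two distinct elements are adjacent iff one of them is a positive integral power of the other. The enhanced power graph $\mathcal{P}_e(G)$: two distinct elements are adjacent iff both are contained in a common cyclic subgroup of $G$. Let $o(g)$ denote the order of $g\in G$. For $A\in\{\mathcal{P},\mathcal{P}_e\}$: the order super $A$ graph $A^o(G)$ is the graph on $G$ in which two distinct elements $g,h$ are adjacent iff either $o(g)=o(h)$, or there exist $g',h'\in G$ with $o(g')=o(g)$, $o(h')=o(h)$ such that $g'$ and $h'$ are adjacent in $A(G)$; the conjugacy super $A$ graph $A^c(G)$ is the graph on $G$ in which two distinct elements $g,h$ are adjacent iff either $g$ and $h$ are conjugate in $G$, or there exist $g'$ conjugate to $g$ and $h'$ conjugate to $h$ in $G$ such that $g'$ and $h'$ are adjacent in $A(G)$. The trivial subgroup (order $1=p^0$) counts as having prime power order. *)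

theory Defs
  imports "HOL-Algebra.Elementary_Groups" "HOL-Algebra.Multiplicative_Group" "HOL-Computational_Algebra.Primes"
    "Graph_Theory.Pair_Digraph"
begin

text \<open>
  A simple undirected graph is an irreflexive, symmetric \<^typ>\<open>'a pair_pre_digraph\<close>: the
  edge between \<open>x\<close> and \<open>y\<close> is the pair of arcs \<open>(x, y)\<close>, \<open>(y, x)\<close>. Equality of these records is
  equality of vertex sets and edge sets. The lemmas at the end confirm that the graphs below
  are simple undirected graphs (\<^locale>\<open>pair_graph\<close>) when the group is finite.
\<close>

definition cyclic_subgroup :: "'a set \<Rightarrow> ('a, 'b) monoid_scheme \<Rightarrow> bool" where
  "cyclic_subgroup H G \<longleftrightarrow> subgroup H G \<and> cyclic_group (G\<lparr>carrier := H\<rparr>)"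

definition conjugate :: "('a, 'b) monoid_scheme \<Rightarrow> 'a \<Rightarrow> 'a \<Rightarrow> bool" where
  "conjugate G x y \<longleftrightarrow> (\<exists>a\<in>carrier G. y = a \<otimes>\<^bsub>G\<^esub> x \<otimes>\<^bsub>G\<^esub> inv\<^bsub>G\<^esub> a)"

definition power_graph :: "('a, 'b) monoid_scheme \<Rightarrow> 'a pair_pre_digraph" where
  "power_graph G = \<lparr>pverts = carrier G,
     parcs = {(x, y). x \<in> carrier G \<and> y \<in> carrier G \<and> x \<noteq> y \<and>
       (\<exists>n::nat. n > 0 \<and> (y = x [^]\<^bsub>G\<^esub> n \<or> x = y [^]\<^bsub>G\<^esub> n))}\<rparr>"

definition enhanced_power_graph :: "('a, 'b) monoid_scheme \<Rightarrow> 'a pair_pre_digraph" where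
  "enhanced_power_graph G = \<lparr>pverts = carrier G,
     parcs = {(x, y). x \<in> carrier G \<and> y \<in> carrier G \<and> x \<noteq> y \<and>
       (\<exists>H. cyclic_subgroup H G \<and> x \<in> H \<and> y \<in> H)}\<rparr>"

definition order_super ::
    "('a, 'b) monoid_scheme \<Rightarrow> 'a pair_pre_digraph \<Rightarrow> 'a pair_pre_digraph" where
  "order_super G A = \<lparr>pverts = carrier G,
     parcs = {(g, h). g \<in> carrier G \<and> h \<in> carrier G \<and> g \<noteq> h \<and>
       (group.ord G g = group.ord G h \<or>
        (\<exists>g'\<in>carrier G. \<exists>h'\<in>carrier G.
          group.ord G g' = group.ord G g \<and> group.ord G h' = group.ord G h \<and>
          (g', h') \<in> parcs A))}\<rparr>"

definition conjugacy_super ::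
    "('a, 'b) monoid_scheme \<Rightarrow> 'a pair_pre_digraph \<Rightarrow> 'a pair_pre_digraph" where
  "conjugacy_super G A = \<lparr>pverts = carrier G,
     parcs = {(g, h). g \<in> carrier G \<and> h \<in> carrier G \<and> g \<noteq> h \<and>
       (conjugate G g h \<or>
        (\<exists>g'\<in>carrier G. \<exists>h'\<in>carrier G.
          conjugate G g g' \<and> conjugate G h h' \<and> (g', h') \<in> parcs A))}\<rparr>"

lemma (in group) conjugate_sym:
  assumes "conjugate G x y" "x \<in> carrier G"
  shows "conjugate G y x"
proof -
  obtain a where a: "a \<in> carrier G" "y = a \<otimes> x \<otimes> inv a"
    using assms(1) by (auto simp: conjugate_def)
  then have "x = inv a \<otimes> y \<otimes> inv (inv a)"
    using assms(2) by (simp add: m_assoc inv_solve_left)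
  then show ?thesis
    using a(1) unfolding conjugate_def by blast
qed

lemma pair_graphI:
  assumes "finite V" "pverts A = V" "parcs A \<subseteq> V \<times> V" "irrefl (parcs A)" "sym (parcs A)"
  shows "pair_graph A"
proof -
  have fin: "finite (parcs A)"
    using assms finite_subset by blast
  show ?thesis
    using assms fin
    by unfold_locales (auto simp: irrefl_def symmetric_def)
qed

lemma pair_graph_power_graph:
  "finite (carrier G) \<Longrightarrow> pair_graph (power_graph G)"
  by (rule pair_graphI[of "carrier G"]) (auto simp: power_graph_def irrefl_def sym_def)

lemma pair_graph_enhanced_power_graph:
  "finite (carrier G) \<Longrightarrow> pair_graph (enhanced_power_graph G)"
  by (rule pair_graphI[of "carrier G"]) (auto simp: enhanced_power_graph_def irrefl_def sym_def)

lemma pair_graph_order_super: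
  assumes "finite (carrier G)" "sym (parcs A)"
  shows "pair_graph (order_super G A)"
proof (rule pair_graphI[of "carrier G"])
  show "sym (parcs (order_super G A))"
    using assms(2) unfolding order_super_def sym_def by simp metis
qed (use assms in \<open>auto simp: order_super_def irrefl_def\<close>)

lemma (in group) pair_graph_conjugacy_super:
  assumes "finite (carrier G)" "sym (parcs A)"
  shows "pair_graph (conjugacy_super G A)"
proof (rule pair_graphI[of "carrier G"])
  show "sym (parcs (conjugacy_super G A))"
    using assms(2) conjugate_sym unfolding conjugacy_super_def sym_def by simp metis
qed (use assms in \<open>auto simp: conjugacy_super_def irrefl_def\<close>)

end

theory Submission
  imports Defs "HOL-Number_Theory.Cong"
begin

text \<open>
  In a cyclic group of prime power order, of any two elements one is a power of the other, so if
  all cyclic subgroups have prime power order then the two base graphs already coincide.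
  Otherwise some cyclic subgroup contains elements \<open>x\<close>, \<open>y\<close> of distinct prime orders. They are
  adjacent in the enhanced power graph, but in the power graph the order of one endpoint of an
  edge divides the order of the other; as conjugate elements have the same order, \<open>x\<close> and \<open>y\<close> are
  adjacent in neither super power graph.
\<close>

text \<open>Split off from \<open>n\<close> its full \<open>p\<close>-part for some prime divisor
  \<open>p\<close>. The cofactor \<open>m\<close> is not 1, as \<open>n\<close> is no power of
  \<open>p\<close>, and a prime divisor of \<open>m\<close> cannot be \<open>p\<close>.\<close>

lemma two_primes_dvd:
  fixes n :: nat
  assumes "n > 0" and npp: "\<nexists>p k. prime p \<and> n = p ^ k"
  obtains p q where "prime p" "prime q" "p \<noteq> q" "p dvd n" "q dvd n"
proof -
  \<comment> \<open>The value 1 is excluded by \<open>npp\<close>, being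
    \<open>2 ^ 0\<close>.\<close>
  have "n \<noteq> 1"
    using npp two_is_prime_nat power_0 by metis
  then obtain p where p: "prime p" "p dvd n"
    using prime_factor_nat by blast
  obtain m where m: "n = p ^ multiplicity p n * m" "\<not> p dvd m"
    using multiplicity_decompose'[of n p] assms(1) p(1) not_prime_unit by blast
  have "m \<noteq> 1"
    using m(1) npp p(1) by (metis mult.right_neutral)
  then obtain q where "prime q" "q dvd m"
    using prime_factor_nat by blast
  with p m show thesis
    using that[of p q] by (metis dvd_mult)
qed

context group
begin

text \<open>Generation inside the group restricted to \<open>H\<close> agrees with generation in
  \<open>G\<close>, so elements of a cyclic subgroup can be treated as powers of one
  \<open>g\<close> in \<open>G\<close>.\<close>

lemma cyclic_subgroup_iff:
  "cyclic_subgroup H G \<longleftrightarrow> (\<exists>g\<in>carrier G. H = generate G {g})"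
proof
  assume "cyclic_subgroup H G"
  then have H: "subgroup H G" and "cyclic_group (G\<lparr>carrier := H\<rparr>)"
    by (auto simp: cyclic_subgroup_def)
  then obtain g where g: "g \<in> H"
    and "subgroup_generated (G\<lparr>carrier := H\<rparr>) {g} = G\<lparr>carrier := H\<rparr>"
    by (auto simp: cyclic_group_def)
  then have "carrier (subgroup_generated (G\<lparr>carrier := H\<rparr>) {g}) = H"
    by simp
  then have "generate (G\<lparr>carrier := H\<rparr>) {g} = H"
    using g by (simp add: carrier_subgroup_generated)
  then have "H = generate G {g}"
    using g H generate_consistent[of "{g}" H] by simp
  with subgroup.mem_carrier[OF H g] show "\<exists>g\<in>carrier G. H = generate G {g}"
    by (rule bexI[rotated])
next
  assume "\<exists>g\<in>carrier G. H = generate G {g}"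
  then obtain g where g: "g \<in> carrier G" "H = generate G {g}" by blast
  then have "subgroup_generated G {g} = G\<lparr>carrier := H\<rparr>"
    by (simp add: subgroup_generated_def)
  then show "cyclic_subgroup H G"
    using g generate_is_subgroup[of "{g}"] cyclic_group_generated[of g]
    by (simp add: cyclic_subgroup_def)
qed

text \<open>The exponent solves the linear congruence \<open>a * n = b\<close> modulo
  \<open>ord g\<close>, which the gcd condition makes solvable.\<close>

lemma pow_in_powers:
  assumes g: "g \<in> carrier G" and "ord g > 0" and dvd: "gcd a (ord g) dvd b"
  obtains n :: nat where "n > 0" "g [^] b = (g [^] a) [^] n"
proof -
  obtain x where "[a * x = b] (mod ord g)"
    using cong_solve_dvd_nat[OF dvd] by blast
  \<comment> \<open>The solution \<open>x\<close> may be 0; shifting it by \<open>ord g\<close>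
    gives the positive exponent that the power graph demands.\<close>
  then have "[a * (x + ord g) = b] (mod ord g)"
    by (simp add: cong_def distrib_left)
  then have "(g [^] a) [^] (x + ord g) = g [^] b"
    using g int_pow_eq[of g "int (a * (x + ord g))" "int b"]
    by (simp add: nat_pow_pow int_pow_int cong_iff_dvd_diff dvd_diff_commute flip: cong_int_iff
        del: of_nat_mult of_nat_add)
  then show thesis
    using that[of "x + ord g"] assms(2) by simp
qed

text \<open>Divisors of \<open>p ^ k\<close> form a chain under divisibility, so one of the gcds of
  \<open>a\<close> and \<open>b\<close> with \<open>ord g\<close> divides the other, and
  \<open>pow_in_powers\<close> applies in that direction.\<close>

lemma power_in_cyclic_prime_power:
  assumes g: "g \<in> carrier G" and p: "prime p" and ord: "ord g = p ^ k"
  shows "\<exists>n::nat. n > 0 \<and>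
    (g [^] (b::nat) = (g [^] (a::nat)) [^] n \<or> g [^] a = (g [^] b) [^] n)"
proof -
  have pos: "ord g > 0"
    using p ord prime_gt_0_nat by simp
  obtain i j where ij: "gcd a (ord g) = p ^ i" "gcd b (ord g) = p ^ j"
    using divides_primepow_nat[OF p] ord by (metis gcd_dvd2)
  then consider "gcd a (ord g) dvd gcd b (ord g)" | "gcd b (ord g) dvd gcd a (ord g)"
    by (metis le_imp_power_dvd nat_le_linear)
  then show ?thesis
  proof cases
    case 1
    then have "gcd a (ord g) dvd b" by (meson dvd_trans gcd_dvd1)
    then show ?thesis using pow_in_powers[OF g pos] by metis
  next
    case 2
    then have "gcd b (ord g) dvd a" by (meson dvd_trans gcd_dvd1)
    then show ?thesis using pow_in_powers[OF g pos] by metis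
  qed
qed

lemma power_graph_eq_enhanced_power_graph:
  assumes fin: "finite (carrier G)"
    and pp: "\<forall>H. cyclic_subgroup H G \<longrightarrow> (\<exists>(p::nat) k. prime p \<and> card H = p ^ k)"
  shows "power_graph G = enhanced_power_graph G"
proof -
  have "(\<exists>n::nat. n > 0 \<and> (y = x [^] n \<or> x = y [^] n)) \<longleftrightarrow>
      (\<exists>H. cyclic_subgroup H G \<and> x \<in> H \<and> y \<in> H)" (is "?P \<longleftrightarrow> ?E")
    if xy: "x \<in> carrier G" "y \<in> carrier G" for x y
  proof
    assume ?P
    then have "y \<in> generate G {x} \<or> x \<in> generate G {y}"
      using xy by (auto simp: generate_pow_on_finite_carrier[OF fin])
    then show ?E
      using xy cyclic_subgroup_iff generate.incl by (metis singletonI)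
  next
    assume ?E
    then obtain H g where H: "cyclic_subgroup H G" "x \<in> H" "y \<in> H"
      and g: "g \<in> carrier G" "H = generate G {g}"
      using cyclic_subgroup_iff by blast
    obtain p :: nat and k where p: "prime p" "card H = p ^ k"
      using pp H(1) by blast
    obtain a b :: nat where "x = g [^] a" "y = g [^] b"
      using H g generate_pow_on_finite_carrier[OF fin g(1)] by auto
    then show ?P
      using power_in_cyclic_prime_power[OF g(1) p(1), of k b a] g p generate_pow_card by simp
  qed
  then show ?thesis
    unfolding power_graph_def enhanced_power_graph_def by auto
qed

lemma enhanced_power_graph_prime_orders:
  assumes fin: "finite (carrier G)" and H: "cyclic_subgroup H G"
    and npp: "\<nexists>(p::nat) k. prime p \<and> card H = p ^ k"
  obtains x y where "(x, y) \<in> parcs (enhanced_power_graph G)"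
    "prime (ord x)" "prime (ord y)" "ord x \<noteq> ord y"
proof -
  obtain g where g: "g \<in> carrier G" "H = generate G {g}"
    using H cyclic_subgroup_iff by blast
  have card: "card H = ord g" and pos: "ord g > 0"
    using g generate_pow_card ord_ge_1[OF fin g(1)] by auto
  obtain p q where pq: "prime p" "prime q" "p \<noteq> q" "p dvd ord g" "q dvd ord g"
    using two_primes_dvd[of "ord g"] npp card pos by metis
  define x where "x = g [^] (ord g div p)"
  define y where "y = g [^] (ord g div q)"
  \<comment> \<open>The cofactor of \<open>r\<close> in the order is the exponent that leaves an
    element of order exactly \<open>r\<close>.\<close>
  have ord: "ord (g [^] (ord g div r)) = r" if "r dvd ord g" for r
  proof -
    obtain c where "ord g = r * c" using \<open>r dvd ord g\<close> by (rule dvdE)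
    then show ?thesis using ord_pow[OF g(1), of c] pos by auto
  qed
  have "x \<in> H" "y \<in> H" "x \<in> carrier G" "y \<in> carrier G"
    unfolding x_def y_def using g generate_pow_on_finite_carrier[OF fin g(1)] by auto
  moreover have "ord x = p" "ord y = q"
    using ord pq by (auto simp: x_def y_def)
  ultimately show thesis
    using that[of x y] H pq by (auto simp: enhanced_power_graph_def)
qed

lemma power_graph_ord_dvd:
  assumes "(x, y) \<in> parcs (power_graph G)"
  shows "ord x dvd ord y \<or> ord y dvd ord x"
proof -
  have "ord (z [^] n) dvd ord z" if "z \<in> carrier G" for z and n :: nat
    using that by (metis nat_pow_closed nat_pow_one nat_pow_pow mult.commute pow_eq_id pow_ord_eq_1)
  then show ?thesis
    using assms by (auto simp: power_graph_def)
qed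

lemma conjugate_refl: "x \<in> carrier G \<Longrightarrow> conjugate G x x"
  unfolding conjugate_def by (rule bexI[of _ \<one>]) auto

text \<open>Conjugation commutes with powers and fixes only the identity as a preimage of the
  identity, so \<open>x\<close> and \<open>y\<close> are killed by the same exponents.\<close>

lemma conjugate_ord:
  assumes "conjugate G x y" "x \<in> carrier G"
  shows "ord y = ord x"
proof -
  obtain a where a: "a \<in> carrier G" "y = a \<otimes> x \<otimes> inv a"
    using assms(1) by (auto simp: conjugate_def)
  have cancel: "inv a \<otimes> (a \<otimes> z) = z" if "z \<in> carrier G" for z
    using a(1) that by (simp flip: m_assoc)
  have pow: "y [^] n = a \<otimes> x [^] n \<otimes> inv a" for n :: nat
    by (induction n) (use a assms(2) cancel in \<open>simp_all add: m_assoc\<close>)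
  have "a \<otimes> z \<otimes> inv a = \<one> \<longleftrightarrow> z = \<one>" if "z \<in> carrier G" for z
    using a(1) that by (simp add: inv_solve_right' l_cancel_one)
  then have "y [^] n = \<one> \<longleftrightarrow> x [^] n = \<one>" for n :: nat
    using pow assms(2) by simp
  then show ?thesis
    using a assms(2) by (simp add: ord_unique pow_eq_id)
qed

text \<open>Holds because conjugates have equal order. It lets a single non-edge of the order super
  graph serve for the conjugacy super graph too.\<close>

lemma parcs_conjugacy_super_subset:
  "parcs (conjugacy_super G A) \<subseteq> parcs (order_super G A)"
  unfolding conjugacy_super_def order_super_def using conjugate_ord by fastforce

lemma enhanced_subset_conjugacy_super:
  "parcs (enhanced_power_graph G) \<subseteq> parcs (conjugacy_super G (enhanced_power_graph G))"
  unfolding conjugacy_super_def enhanced_power_graph_def using conjugate_refl by fastforce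

lemma order_super_power_graph_ord:
  assumes "(x, y) \<in> parcs (order_super G (power_graph G))"
  shows "ord x dvd ord y \<or> ord y dvd ord x"
  using assms power_graph_ord_dvd unfolding order_super_def by fastforce

end

theorem theorem3p2:
  fixes G :: "('a, 'b) monoid_scheme"
  assumes "group G" and "finite (carrier G)"
  shows "(order_super G (power_graph G) = order_super G (enhanced_power_graph G) \<longleftrightarrow>
          conjugacy_super G (power_graph G) = conjugacy_super G (enhanced_power_graph G)) \<and>
         (conjugacy_super G (power_graph G) = conjugacy_super G (enhanced_power_graph G) \<longleftrightarrow>
          (\<forall>H. cyclic_subgroup H G \<longrightarrow> (\<exists>(p::nat) k. prime p \<and> card H = p ^ k)))"
proof -
  interpret group G by fact
  show ?thesis
  proof (cases "\<forall>H. cyclic_subgroup H G \<longrightarrow> (\<exists>(p::nat) k. prime p \<and> card H = p ^ k)")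
    case True
    then show ?thesis
      using power_graph_eq_enhanced_power_graph[OF assms(2)] by simp
  next
    case False
    then obtain x y where xy: "(x, y) \<in> parcs (enhanced_power_graph G)"
      "prime (ord x)" "prime (ord y)" "ord x \<noteq> ord y"
      using enhanced_power_graph_prime_orders[OF assms(2)] by metis
    have "(x, y) \<notin> parcs (order_super G (power_graph G))"
      using order_super_power_graph_ord xy by (metis primes_dvd_imp_eq)
    \<comment> \<open>The pair is an edge of both super graphs of the enhanced power graph and of
      neither super graph of the power graph, so all three statements fail together.\<close>
    then show ?thesis
      using False xy(1) enhanced_subset_conjugacy_super parcs_conjugacy_super_subset
      by (metis subsetD)
  qed
qed

end
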